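(* For every $n\ge1$ there exists a bijection $\phi:\mathbf{I}_n(010,101)\to\mathbf{I}_n(010,100)$ which preserves the triple of statistics $(\operatorname{dist},\operatorname{satu},\operatorname{zero})$. Consequently, the statistic $\operatorname{rep}$ is 2nd Stirling over $\mathbf{I}_n(010,100)$, i.e. for all $1\le k\le n$, $$|\{e\in\mathbf{I}_n(010,100):\operatorname{rep}(e)=k\}|=S(n,k),$$ where $S(n,k)$ is the Stirling number of the second kind.
   Context: An inversion sequence of length $n$ is an integer sequence $e=(e_1,\dots,e_n)$ with $0\le e_i\le i-1$ for all $1\le i\le n$. A word $w_1\cdots w_n$ avoids a pattern $P=p_1\cdots p_k$ if there are no $i_1<\cdots<i_k$ such that $w_{i_1}\cdots w_{i_k}$ is order isomorphic to $P$ (equal letters of $P$ corresponding to equal entries). $\mathbf{I}_n(P_1,\dots,P_r)$ denotes the set of inversion sequences of length $n$ avoiding all of $P_1,\dots,P_r$. For $e\in\mathbf{I}_n$: $\operatorname{dist}(e)=|\{e_1,\dots,e_n\}\setminus\{0\}|$ is the number of distinct positive entries; $\operatorname{satu}(e)=|\{i\in[n]:e_i=i-1\}|$; $\operatorname{zero}(e)=|\{i\in[n]:e_i=0\}|$; $\operatorname{rep}(e)=n-\operatorname{dist}(e)$. $S(n,k)$ is the number of partitions of $[n]$ into $k$ blocks. A statistic is 2nd Stirling over a combinatorial object if its distribution over that object is given by the Stirling numbers of the second kind. *)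

theory Defs
  imports Main "HOL-Library.Sublist" "HOL-Library.Disjoint_Sets" "HOL-Combinatorics.Stirling"
begin

text \<open>
  Words are lists of natural numbers. Lists are indexed from 0, so the entry written
  \<open>e\<^sub>i\<close> with \<open>1 \<le> i \<le> n\<close> is \<open>e ! (i - 1)\<close>; the bounds \<open>0 \<le> e\<^sub>i \<le> i - 1\<close> become
  \<open>e ! i \<le> i\<close> and the condition \<open>e\<^sub>i = i - 1\<close> becomes \<open>e ! i = i\<close>.
\<close>

definition inversion_sequence :: "nat list \<Rightarrow> bool" where
  "inversion_sequence e \<longleftrightarrow> (\<forall>i < length e. e ! i \<le> i)"

definition order_isomorphic :: "nat list \<Rightarrow> nat list \<Rightarrow> bool" where
  "order_isomorphic u v \<longleftrightarrow> length u = length v \<and>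
     (\<forall>i < length u. \<forall>j < length u.
        (u ! i < u ! j \<longleftrightarrow> v ! i < v ! j) \<and> (u ! i = u ! j \<longleftrightarrow> v ! i = v ! j))"

definition avoids :: "nat list \<Rightarrow> nat list \<Rightarrow> bool" where
  "avoids w P \<longleftrightarrow> \<not> (\<exists>u. subseq u w \<and> order_isomorphic u P)"

definition inversion_sequences_avoiding :: "nat \<Rightarrow> nat list set \<Rightarrow> nat list set" where
  "inversion_sequences_avoiding n Ps =
     {e. length e = n \<and> inversion_sequence e \<and> (\<forall>P \<in> Ps. avoids e P)}"

definition dist_stat :: "nat list \<Rightarrow> nat" where
  "dist_stat e = card (set e - {0})"

definition satu_stat :: "nat list \<Rightarrow> nat" where
  "satu_stat e = card {i. i < length e \<and> e ! i = i}"

definition zero_stat :: "nat list \<Rightarrow> nat" where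
  "zero_stat e = card {i. i < length e \<and> e ! i = 0}"

text \<open>The subtraction does not truncate: a list has at most \<open>length e\<close> distinct entries.\<close>

definition rep_stat :: "nat list \<Rightarrow> nat" where
  "rep_stat e = length e - dist_stat e"

definition stirling2 :: "nat \<Rightarrow> nat \<Rightarrow> nat" where
  "stirling2 n k = card {P. partition_on {1..n} P \<and> card P = k}"

text \<open>
  The library's \<^const>\<open>Stirling\<close> is defined by the recurrence; it is the same function.
\<close>

lemma finite_partitions:
  assumes "finite A"
  shows "finite {P. partition_on A P \<and> card P = k}"
  using finitely_many_partition_on[OF assms] by (rule finite_subset[rotated]) auto

lemma card_partitions_insert:
  fixes A :: "'a set"
  assumes fin: "finite A" and x: "x \<notin> A"
  shows "card {P. partition_on (insert x A) P \<and> card P = Suc k} =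
    Suc k * card {P. partition_on A P \<and> card P = Suc k} + card {P. partition_on A P \<and> card P = k}"
proof -
  let ?Q = "\<lambda>k. {P. partition_on A P \<and> card P = k}"
  let ?X = "{P. partition_on (insert x A) P \<and> card P = Suc k}"
  let ?X1 = "{P \<in> ?X. {x} \<in> P}" and ?X2 = "{P \<in> ?X. {x} \<notin> P}"
  have finX: "finite ?X" using fin by (intro finite_partitions) simp
  have finP: "finite P" if "partition_on B P" "finite B" for B :: "'a set" and P
    using that finite_elements by blast
  have uniq: "B = C" if "partition_on D P" "B \<in> P" "C \<in> P" "y \<in> B" "y \<in> C"
    for B C D :: "'a set" and P y
    using that unfolding partition_on_def disjoint_def by blast
  have rem: "partition_on (D - B) (P - {B})" if "partition_on D P" "B \<in> P" for B D :: "'a set" and P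
  proof -
    have "disjnt B (\<Union>(P - {B}))" using that uniq unfolding disjnt_iff by blast
    then show ?thesis
      using partition_on_insert[of B "P - {B}" D] that by (simp add: insert_absorb)
  qed
  have ins: "partition_on E (insert C P)"
    if "partition_on D P" "C \<inter> D = {}" "C \<noteq> {}" "E = C \<union> D" for C D E :: "'a set" and P
  proof -
    have "disjnt C (\<Union>P)" "E - C = D" using that partition_onD1[of D P] by (auto simp: disjnt_def)
    then show ?thesis using partition_on_insert[of C P E] that by simp
  qed
  have 1: "bij_betw (insert {x}) (?Q k) ?X1"
  proof (rule bij_betw_byWitness[where f' = "\<lambda>P. P - {{x}}"])
    have nx: "{x} \<notin> P" if "partition_on A P" for P
      using that x by (auto simp: partition_on_def)
    show "\<forall>P\<in>?Q k. insert {x} P - {{x}} = P" using nx by auto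
    show "\<forall>P\<in>?X1. insert {x} (P - {{x}}) = P" by auto
    show "insert {x} ` ?Q k \<subseteq> ?X1"
    proof (rule image_subsetI)
      fix P assume "P \<in> ?Q k"
      then have P: "partition_on A P" and k: "card P = k" by auto
      have "partition_on (insert x A) (insert {x} P)"
        using P x by (intro ins[of A]) auto
      moreover have "card (insert {x} P) = Suc k"
        using nx[OF P] finP[OF P fin] k by simp
      ultimately show "insert {x} P \<in> ?X1" by blast
    qed
    show "(\<lambda>P. P - {{x}}) ` ?X1 \<subseteq> ?Q k"
    proof (rule image_subsetI)
      fix P assume "P \<in> ?X1"
      then have P: "partition_on (insert x A) P" "{x} \<in> P" and k: "card P = Suc k" by auto
      have "partition_on A (P - {{x}})"
        using rem[OF P] x by simp
      moreover have "card (P - {{x}}) = k"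
        using P(2) k by (simp add: card_Diff_singleton)
      ultimately show "P - {{x}} \<in> ?Q k" by blast
    qed
  qed
  let ?f = "\<lambda>(P, B). insert (insert x B) (P - {B})"
  let ?g = "\<lambda>P. let B = (THE B. B \<in> P \<and> x \<in> B) in (insert (B - {x}) (P - {B}), B - {x})"
  let ?S = "Sigma (?Q (Suc k)) (\<lambda>P. P)"
  have the1: "(THE B. B \<in> P \<and> x \<in> B) = C"
    if "partition_on D P" "C \<in> P" "x \<in> C" for P C D
    using that uniq[OF that(1)] by (intro the_equality) blast+
  have nx: "x \<notin> B" if "partition_on A P" "B \<in> P" for P B
    using that x by (auto simp: partition_on_def)
  have fS: "partition_on (insert x A) (insert (insert x B) (P - {B}))"
    "card (insert (insert x B) (P - {B})) = card P"
    "{x} \<notin> insert (insert x B) (P - {B})"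
    if P: "partition_on A P" and B: "B \<in> P" for P B
  proof -
    show "partition_on (insert x A) (insert (insert x B) (P - {B}))"
    proof (rule ins[OF rem[OF P B]])
      show "insert x B \<inter> (A - B) = {}" using x by blast
      show "insert x A = insert x B \<union> (A - B)" using partition_onD1[OF P] B by blast
    qed simp
    have "insert x B \<notin> P - {B}" using nx[OF P] by blast
    then show "card (insert (insert x B) (P - {B})) = card P"
      using card.remove[OF finP[OF P fin] B] finP[OF P fin] by simp
    have "B \<noteq> {}" using P B by (auto simp: partition_on_def)
    then show "{x} \<notin> insert (insert x B) (P - {B})"
      using nx[OF P B] nx[OF P] by blast
  qed
  have gX: "\<exists>B. B \<in> P \<and> x \<in> B \<and> partition_on A (insert (B - {x}) (P - {B}))
      \<and> card (insert (B - {x}) (P - {B})) = card P \<and> B - {x} \<notin> P"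
    if P: "partition_on (insert x A) P" and nP: "{x} \<notin> P" for P
  proof -
    obtain B where B: "B \<in> P" "x \<in> B" using P by (auto simp: partition_on_def)
    have "B \<noteq> {x}" using B nP by blast
    then have ne: "B - {x} \<noteq> {}" using B by blast
    then have notin: "B - {x} \<notin> P" using uniq[OF P B(1)] B by blast
    have "partition_on A (insert (B - {x}) (P - {B}))"
    proof (rule ins[OF rem[OF P B(1)] _ ne])
      show "(B - {x}) \<inter> (insert x A - B) = {}" by blast
      show "A = (B - {x}) \<union> (insert x A - B)" using partition_onD1[OF P] B x by blast
    qed
    moreover have "card (insert (B - {x}) (P - {B})) = card P"
      using card.remove[OF finP[OF P] B(1)] finP[OF P] fin notin by simp
    ultimately show ?thesis using B notin by blast
  qed
  have 2: "bij_betw ?f ?S ?X2"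
  proof (rule bij_betw_byWitness[where f' = ?g])
    show "\<forall>a\<in>?S. ?g (?f a) = a"
    proof
      fix a assume "a \<in> ?S"
      then obtain P B where a: "a = (P, B)" and P: "partition_on A P" "card P = Suc k" "B \<in> P"
        by auto
      have t: "(THE C. C \<in> insert (insert x B) (P - {B}) \<and> x \<in> C) = insert x B"
        by (rule the1[OF fS(1)[OF P(1,3)]]) auto
      have "insert x B \<notin> P" using nx[OF P(1)] by blast
      then show "?g (?f a) = a"
        unfolding a prod.case t Let_def using nx[OF P(1,3)] P(3) by auto
    qed
    show "\<forall>P\<in>?X2. ?f (?g P) = P"
    proof
      fix P assume "P \<in> ?X2"
      then have P: "partition_on (insert x A) P" "{x} \<notin> P" by auto
      obtain B where B: "B \<in> P" "x \<in> B" "B - {x} \<notin> P" using gX[OF P] by blast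
      have t: "(THE C. C \<in> P \<and> x \<in> C) = B" by (rule the1[OF P(1) B(1,2)])
      show "?f (?g P) = P" unfolding t Let_def using B by (auto simp: insert_absorb)
    qed
    show "?f ` ?S \<subseteq> ?X2"
    proof (rule image_subsetI)
      fix a assume "a \<in> ?S"
      then obtain P B where a: "a = (P, B)" and P: "partition_on A P" "card P = Suc k" "B \<in> P"
        by auto
      show "?f a \<in> ?X2"
        unfolding a prod.case mem_Collect_eq using fS[OF P(1,3)] P(2) by (intro conjI) simp_all
    qed
    show "?g ` ?X2 \<subseteq> ?S"
    proof
      fix y assume "y \<in> ?g ` ?X2"
      then obtain P where y: "y = ?g P" and P: "partition_on (insert x A) P" "{x} \<notin> P" "card P = Suc k"
        by auto
      obtain B where B: "B \<in> P" "x \<in> B" "partition_on A (insert (B - {x}) (P - {B}))"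
        "card (insert (B - {x}) (P - {B})) = card P" using gX[OF P(1,2)] by blast
      have t: "(THE C. C \<in> P \<and> x \<in> C) = B" by (rule the1[OF P(1) B(1,2)])
      show "y \<in> ?S" unfolding y t Let_def using B(3,4) P(3) by simp
    qed
  qed
  have "card ?X = card ?X1 + card ?X2"
  proof -
    have "finite ?X1" "finite ?X2" by (rule finite_subset[OF _ finX], blast)+
    moreover have "?X1 \<inter> ?X2 = {}" by blast
    ultimately have "card (?X1 \<union> ?X2) = card ?X1 + card ?X2" by (rule card_Un_disjoint)
    moreover have "?X1 \<union> ?X2 = ?X" by blast
    ultimately show ?thesis by simp
  qed
  also have "card ?X1 = card (?Q k)" using bij_betw_same_card[OF 1] by simp
  also have "card ?X2 = card ?S" using bij_betw_same_card[OF 2] by simp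
  also have "card ?S = (\<Sum>P\<in>?Q (Suc k). card P)"
  proof (rule card_SigmaI)
    show "finite (?Q (Suc k))" by (rule finite_partitions[OF fin])
    show "\<forall>P\<in>?Q (Suc k). finite P" using finP fin by blast
  qed
  also have "\<dots> = Suc k * card (?Q (Suc k))" by simp
  finally show ?thesis by simp
qed

lemma card_partitions:
  assumes "finite A"
  shows "card {P. partition_on A P \<and> card P = k} = Stirling (card A) k"
  using assms
proof (induction A arbitrary: k rule: finite_induct)
  case empty
  show ?case by (cases k) (simp_all add: partition_on_empty Collect_conv_if)
next
  case (insert x A)
  show ?case
  proof (cases k)
    case 0
    have "card P \<noteq> 0" if "partition_on (insert x A) P" for P
    proof -
      have "finite P" using finite_elements[OF _ that] insert.hyps(1) by simp
      moreover have "P \<noteq> {}" using partition_onD1[OF that] by blast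
      ultimately show ?thesis by simp
    qed
    then have none: "{P. partition_on (insert x A) P \<and> card P = k} = {}" using 0 by blast
    show ?thesis unfolding none using insert.hyps 0 by simp
  next
    case (Suc m)
    show ?thesis unfolding Suc card_partitions_insert[OF insert.hyps]
      by (simp add: insert.IH insert.hyps)
  qed
qed

lemma stirling2_eq_Stirling: "stirling2 n k = Stirling n k"
  by (simp add: stirling2_def card_partitions)

end

theory Submission
  imports Defs
begin

text \<open>
  Both classes are grown one entry at a time by the same rule. A word \<open>w\<close> of the class may be
  followed by any value \<open>x \<le> length w\<close> that does not yet occur in \<open>w\<close>, or by exactly one old
  value. Avoiding \<open>010\<close> and \<open>101\<close> says that equal entries are contiguous, so there the old value
  is the last entry of \<open>w\<close>. Avoiding \<open>010\<close> and \<open>100\<close> says that an entry repeating an earlier one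
  is at least as large as everything before it, so there the old value is the maximum of \<open>w\<close>.

  The bijection therefore keeps each first occurrence where it is and replaces each repeated
  entry by the old value that the other class prescribes (\<open>retarget\<close>). It does not change the
  set of values of any prefix, which gives \<open>dist\<close> and makes the map invertible. A repeated entry
  is smaller than its index counted from \<open>0\<close>, so \<open>satu\<close> only sees first occurrences. In either class the
  prescribed old value is \<open>0\<close> exactly when all entries so far are \<open>0\<close>; this gives \<open>zero\<close>.

  For the distribution of \<open>rep\<close>, a nonempty inversion sequence \<open>e\<close> of length \<open>n\<close> contains \<open>0\<close>, so
  \<open>rep e\<close> is the number of values in \<open>{0..n}\<close> that \<open>e\<close> misses. These are the new values that can
  be appended, and appending one of them keeps \<open>rep\<close>; appending the old value raises \<open>rep\<close> by one.
  This is the recurrence \<open>S(n+1,k+1) = (k+1) S(n,k+1) + S(n,k)\<close>.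
\<close>

section \<open>Words grown by new values and one prescribed old value\<close>

text \<open>
  The function \<open>c\<close> names the old value that may be repeated. Its value on the empty word is
  arbitrary, since the first entry is always new.
\<close>

inductive grown :: "(nat list \<Rightarrow> nat) \<Rightarrow> nat list \<Rightarrow> bool" for c where
  Nil: "grown c []"
| snoc: "grown c w \<Longrightarrow> x \<le> length w \<Longrightarrow> (x \<in> set w \<Longrightarrow> x = c w) \<Longrightarrow> grown c (w @ [x])"

lemma grown_snoc_iff:
  "grown c (w @ [x]) \<longleftrightarrow> grown c w \<and> x \<le> length w \<and> (x \<in> set w \<longrightarrow> x = c w)"
  by (auto elim: grown.cases intro: grown.snoc)

lemma inversion_sequence_snoc_iff:
  "inversion_sequence (w @ [x]) \<longleftrightarrow> inversion_sequence w \<and> x \<le> length w"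
  unfolding inversion_sequence_def by (auto simp: nth_append less_Suc_eq)

lemma grown_inversion_sequence: "grown c w \<Longrightarrow> inversion_sequence w"
  by (induction rule: grown.induct)
    (simp_all add: inversion_sequence_snoc_iff, simp add: inversion_sequence_def)

lemma inversion_sequence_less_length:
  assumes "inversion_sequence w" "x \<in> set w"
  shows "x < length w"
  using assms by (auto simp: inversion_sequence_def in_set_conv_nth intro: le_less_trans)

lemma zero_in_inversion_sequence:
  assumes "inversion_sequence w" "w \<noteq> []"
  shows "0 \<in> set w"
proof -
  have "w ! 0 = 0" using assms by (auto simp: inversion_sequence_def)
  then show ?thesis using assms(2) by (metis length_greater_0_conv nth_mem)
qed

section \<open>Exchanging the prescribed old value\<close>

text \<open>
  The test looks in the output built so far instead of the input read so far: if \<open>c\<close> always picks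
  an entry of its argument, a repeated entry is replaced by a value that has already occurred, so
  output and input have the same set of values.
\<close>

definition retarget :: "(nat list \<Rightarrow> nat) \<Rightarrow> nat list \<Rightarrow> nat list" where
  "retarget c w = foldl (\<lambda>v x. v @ [if x \<in> set v then c v else x]) [] w"

lemma retarget_Nil [simp]: "retarget c [] = []"
  by (simp add: retarget_def)

lemma length_retarget [simp]: "length (retarget c w) = length w"
  by (induction w rule: rev_induct) (simp_all add: retarget_def)

lemma set_retarget:
  assumes "\<And>w. w \<noteq> [] \<Longrightarrow> c w \<in> set w"
  shows "set (retarget c w) = set w"
proof (induction w rule: rev_induct)
  case (snoc x w)
  have "c (retarget c w) \<in> set w" if "x \<in> set w"
    using assms[of "retarget c w"] snoc that by fastforce
  then show ?case using snoc by (auto simp: retarget_def)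
qed simp

lemma retarget_snoc:
  assumes "\<And>w. w \<noteq> [] \<Longrightarrow> c w \<in> set w"
  shows "retarget c (w @ [x]) = retarget c w @ [if x \<in> set w then c (retarget c w) else x]"
  using set_retarget[OF assms, of w] by (simp add: retarget_def)

lemma grown_retarget:
  assumes c: "\<And>w. w \<noteq> [] \<Longrightarrow> c w \<in> set w" and "inversion_sequence w"
  shows "grown c (retarget c w)"
  using assms(2)
proof (induction w rule: rev_induct)
  case Nil
  show ?case by (simp add: grown.Nil)
next
  case (snoc x w)
  have IH: "grown c (retarget c w)" and x: "x \<le> length w"
    using snoc by (auto simp: inversion_sequence_snoc_iff)
  have "c (retarget c w) \<le> length w" if "x \<in> set w"
  proof -
    have "c (retarget c w) \<in> set (retarget c w)"
      using that by (intro c) (auto simp flip: length_greater_0_conv)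
    from inversion_sequence_less_length[OF grown_inversion_sequence[OF IH] this]
    show ?thesis by simp
  qed
  then show ?case
    using IH x by (auto simp: retarget_snoc[OF c] grown_snoc_iff set_retarget[OF c])
qed

text \<open>
  Both maps preserve the set of values of every prefix, so both rewrite the same positions. At
  these positions a word grown by \<open>d\<close> can only hold the value that \<open>d\<close> prescribes.
\<close>

lemma retarget_retarget:
  assumes c: "\<And>w. w \<noteq> [] \<Longrightarrow> c w \<in> set w" and d: "\<And>w. w \<noteq> [] \<Longrightarrow> d w \<in> set w"
    and "grown d w"
  shows "retarget d (retarget c w) = w"
  using assms(3)
proof induction
  case Nil
  show ?case by simp
next
  case (snoc w x)
  have "c (retarget c w) \<in> set w" if "x \<in> set w"
    using c[of "retarget c w"] that
    by (metis c empty_iff list.set(1) set_retarget)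
  then show ?case
    using snoc by (simp add: retarget_snoc[OF c] retarget_snoc[OF d] set_retarget[OF c])
qed

lemma bij_betw_retarget:
  assumes c: "\<And>w. w \<noteq> [] \<Longrightarrow> c w \<in> set w" and d: "\<And>w. w \<noteq> [] \<Longrightarrow> d w \<in> set w"
  shows "bij_betw (retarget c) {w. length w = n \<and> grown d w} {w. length w = n \<and> grown c w}"
proof (rule bij_betw_byWitness[where f' = "retarget d"])
  show "retarget c ` {w. length w = n \<and> grown d w} \<subseteq> {w. length w = n \<and> grown c w}"
    using grown_retarget[of c] grown_inversion_sequence c by auto
  show "retarget d ` {w. length w = n \<and> grown c w} \<subseteq> {w. length w = n \<and> grown d w}"
    using grown_retarget[of d] grown_inversion_sequence d by auto
qed (use retarget_retarget[of c d] retarget_retarget[of d c] c d in auto)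

section \<open>Preservation of the statistics\<close>

lemma satu_stat_snoc: "satu_stat (w @ [x]) = satu_stat w + (if x = length w then 1 else 0)"
proof -
  have "{i. i < length (w @ [x]) \<and> (w @ [x]) ! i = i} =
      {i. i < length w \<and> w ! i = i} \<union> (if x = length w then {length w} else {})"
    by (auto simp: nth_append less_Suc_eq)
  then show ?thesis by (simp add: satu_stat_def)
qed

lemma zero_stat_snoc: "zero_stat (w @ [x]) = zero_stat w + (if x = 0 then 1 else 0)"
proof -
  have "{i. i < length (w @ [x]) \<and> (w @ [x]) ! i = 0} =
      {i. i < length w \<and> w ! i = 0} \<union> (if x = 0 then {length w} else {})"
    by (auto simp: nth_append less_Suc_eq)
  then show ?thesis by (simp add: zero_stat_def)
qed

lemma dist_stat_retarget:
  assumes "\<And>w. w \<noteq> [] \<Longrightarrow> c w \<in> set w"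
  shows "dist_stat (retarget c w) = dist_stat w"
  by (simp add: dist_stat_def set_retarget[OF assms])

lemma satu_stat_retarget:
  assumes c: "\<And>w. w \<noteq> [] \<Longrightarrow> c w \<in> set w" and "inversion_sequence w"
  shows "satu_stat (retarget c w) = satu_stat w"
  using assms(2)
proof (induction w rule: rev_induct)
  case (snoc x w)
  have inv: "inversion_sequence w" using snoc.prems by (simp add: inversion_sequence_snoc_iff)
  have "x \<noteq> length w \<and> c (retarget c w) \<noteq> length w" if "x \<in> set w"
  proof -
    have "retarget c w \<noteq> []" using that by (auto simp flip: length_greater_0_conv)
    from c[OF this] have "c (retarget c w) \<in> set w" by (simp add: set_retarget[OF c])
    from inversion_sequence_less_length[OF inv this] inversion_sequence_less_length[OF inv that]
    show ?thesis by simp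
  qed
  then show ?case
    using snoc.IH[OF inv]
    by (cases "x \<in> set w") (simp_all add: retarget_snoc[OF c] satu_stat_snoc)
qed simp

text \<open>
  The hypotheses \<open>c0\<close> and \<open>d0\<close> ensure that both rules repeat a \<open>0\<close> at the same steps, namely while
  the word consists of zeros only.
\<close>

lemma zero_stat_retarget:
  assumes c: "\<And>w. w \<noteq> [] \<Longrightarrow> c w \<in> set w" and d: "\<And>w. w \<noteq> [] \<Longrightarrow> d w \<in> set w"
    and c0: "\<And>w. grown c w \<Longrightarrow> w \<noteq> [] \<Longrightarrow> c w = 0 \<Longrightarrow> set w \<subseteq> {0}"
    and d0: "\<And>w. grown d w \<Longrightarrow> w \<noteq> [] \<Longrightarrow> d w = 0 \<Longrightarrow> set w \<subseteq> {0}"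
    and "grown d w"
  shows "zero_stat (retarget c w) = zero_stat w"
  using assms(5)
proof induction
  case Nil
  show ?case by simp
next
  case (snoc w x)
  have "x = 0 \<longleftrightarrow> c (retarget c w) = 0" if x: "x \<in> set w"
  proof -
    let ?v = "retarget c w"
    have ne: "w \<noteq> []" "?v \<noteq> []" using x by (auto simp flip: length_greater_0_conv)
    have v: "grown c ?v" "set ?v = set w"
      by (rule grown_retarget[OF c grown_inversion_sequence[OF snoc.hyps(1)]],
        assumption) (rule set_retarget[OF c])
    have "d w = 0 \<longleftrightarrow> set w \<subseteq> {0}" using d0[OF snoc.hyps(1) ne(1)] d[OF ne(1)] by auto
    moreover have "c ?v = 0 \<longleftrightarrow> set w \<subseteq> {0}" using c0[OF v(1) ne(2)] c[OF ne(2)] v(2) by auto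
    ultimately show ?thesis using snoc.hyps(3)[OF x] by simp
  qed
  then show ?case
    using snoc.IH by (cases "x \<in> set w") (simp_all add: retarget_snoc[OF c] zero_stat_snoc)
qed

section \<open>Distribution of the statistic rep\<close>

text \<open>
  The set has \<open>length w + 1\<close> elements minus the \<open>dist w + 1\<close> values of \<open>w\<close>, as \<open>0\<close> is one of them.
\<close>

lemma rep_stat_eq_card_missing:
  assumes inv: "inversion_sequence w" and ne: "w \<noteq> []"
  shows "rep_stat w = card ({..length w} - set w)"
proof -
  have "set w \<subseteq> {..length w}" using inversion_sequence_less_length[OF inv] by force
  then have "card ({..length w} - set w) = Suc (length w) - card (set w)"
    by (simp add: card_Diff_subset)
  moreover have "card (set w) = Suc (dist_stat w)"
    unfolding dist_stat_def
    using card.remove[OF _ zero_in_inversion_sequence[OF inv ne]] by simp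
  ultimately show ?thesis by (simp add: rep_stat_def)
qed

text \<open>
  Lengthening the word admits one more value, \<open>Suc (length w)\<close>, which is missing. A new entry \<open>x\<close>
  removes one missing value in exchange; an old one does not.
\<close>

lemma rep_stat_snoc:
  assumes inv: "inversion_sequence (w @ [x])" and ne: "w \<noteq> []"
  shows "rep_stat (w @ [x]) = (if x \<in> set w then Suc (rep_stat w) else rep_stat w)"
proof -
  have w: "inversion_sequence w" and x: "x \<le> length w"
    using inv by (simp_all add: inversion_sequence_snoc_iff)
  have "Suc (length w) \<notin> set w" using inversion_sequence_less_length[OF w] by force
  then have eq: "{..length (w @ [x])} - set (w @ [x]) =
      insert (Suc (length w)) (({..length w} - set w) - {x})"
    using x by (auto simp: le_Suc_eq)
  have "rep_stat (w @ [x]) = Suc (card (({..length w} - set w) - {x}))"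
    using rep_stat_eq_card_missing[OF inv] eq by simp
  also have "\<dots> = (if x \<in> set w then Suc (rep_stat w) else rep_stat w)"
  proof (cases "x \<in> set w")
    case True
    then show ?thesis by (simp add: rep_stat_eq_card_missing[OF w ne])
  next
    case False
    then show ?thesis
      using card.remove[of "{..length w} - set w" x] x
      by (simp add: rep_stat_eq_card_missing[OF w ne])
  qed
  finally show ?thesis .
qed

lemma finite_grown: "finite {w. length w = n \<and> grown c w}"
proof (rule finite_subset)
  show "{w. length w = n \<and> grown c w} \<subseteq> {w. set w \<subseteq> {..n} \<and> length w = n}"
    using inversion_sequence_less_length[OF grown_inversion_sequence] by fastforce
qed (simp add: finite_lists_length_eq)

text \<open>
  The hypothesis \<open>n \<ge> 1\<close> matters: the empty word has no old value to repeat, and its only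
  extension \<open>[0]\<close> has a new value but a larger \<open>rep\<close>.
\<close>

lemma card_grown_rep_Suc:
  assumes c: "\<And>w. w \<noteq> [] \<Longrightarrow> c w \<in> set w" and n: "n \<ge> 1"
  shows "card {w. length w = Suc n \<and> grown c w \<and> rep_stat w = Suc k} =
    Suc k * card {w. length w = n \<and> grown c w \<and> rep_stat w = Suc k} +
    card {w. length w = n \<and> grown c w \<and> rep_stat w = k}"
proof -
  let ?A = "\<lambda>n k. {w. length w = n \<and> grown c w \<and> rep_stat w = k}"
  let ?old = "(\<lambda>w. w @ [c w]) ` ?A n k"
  let ?S = "Sigma (?A n (Suc k)) (\<lambda>w. {..n} - set w)"
  let ?new = "(\<lambda>(w, x). w @ [x]) ` ?S"
  have fin: "finite (?A n k)" for n k
    by (rule finite_subset[OF _ finite_grown[of n c]]) auto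
  have missing: "rep_stat w = card ({..n} - set w)" if "grown c w" "length w = n" for w
    using rep_stat_eq_card_missing[OF grown_inversion_sequence[OF that(1)]] that(2) n by force
  have rep: "rep_stat (w @ [x]) = (if x \<in> set w then Suc (rep_stat w) else rep_stat w)"
    if "grown c (w @ [x])" "length w = n" for w x
    using rep_stat_snoc[OF grown_inversion_sequence[OF that(1)]] that(2) n by force
  have split: "?A (Suc n) (Suc k) = ?old \<union> ?new"
  proof
    show "?A (Suc n) (Suc k) \<subseteq> ?old \<union> ?new"
    proof
      fix v assume v: "v \<in> ?A (Suc n) (Suc k)"
      then obtain w x where vx: "v = w @ [x]" by (cases v rule: rev_cases) auto
      show "v \<in> ?old \<union> ?new"
        using v rep[of w x] by (cases "x \<in> set w") (auto simp: vx grown_snoc_iff)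
    qed
    show "?old \<union> ?new \<subseteq> ?A (Suc n) (Suc k)"
    proof -
      have "w @ [c w] \<in> ?A (Suc n) (Suc k)" if w: "w \<in> ?A n k" for w
      proof -
        have ne: "c w \<in> set w" using w n by (intro c) auto
        have "grown c (w @ [c w])"
          using w inversion_sequence_less_length[OF grown_inversion_sequence ne]
          by (auto simp: grown_snoc_iff intro: less_imp_le)
        then show ?thesis using w rep[of w "c w"] ne by simp
      qed
      moreover have "w @ [x] \<in> ?A (Suc n) (Suc k)" if "(w, x) \<in> ?S" for w x
      proof -
        have "grown c (w @ [x])" using that by (auto simp: grown_snoc_iff)
        then show ?thesis using that rep[of w x] by simp
      qed
      ultimately show ?thesis
        by (intro Un_least image_subsetI) (simp_all only: split_paired_all prod.case)
    qed
  qed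
  have disj: "?old \<inter> ?new = {}"
  proof -
    have "c w \<in> set w" if "w \<in> ?A n k" for w using that n by (intro c) auto
    then show ?thesis by fastforce
  qed
  have "finite ?old" using fin by simp
  moreover have "finite ?new" using fin by (intro finite_imageI finite_SigmaI) simp_all
  ultimately have "card (?A (Suc n) (Suc k)) = card ?old + card ?new"
    unfolding split using disj by (rule card_Un_disjoint)
  also have "card ?old = card (?A n k)" by (intro card_image) (auto simp: inj_on_def)
  also have "card ?new = card ?S" by (intro card_image) (auto simp: inj_on_def)
  also have "card ?S = (\<Sum>w\<in>?A n (Suc k). card ({..n} - set w))"
    using fin by (intro card_SigmaI) auto
  also have "\<dots> = (\<Sum>w\<in>?A n (Suc k). Suc k)"
    using missing by (intro sum.cong refl) auto
  also have "\<dots> = Suc k * card (?A n (Suc k))" by simp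
  finally show ?thesis by simp
qed

lemma card_grown_rep:
  assumes c: "\<And>w. w \<noteq> [] \<Longrightarrow> c w \<in> set w" and "n \<ge> 1"
  shows "card {w. length w = n \<and> grown c w \<and> rep_stat w = k} = Stirling n k"
  using assms(2)
proof (induction n arbitrary: k rule: dec_induct)
  case base
  have "grown c [0]" using grown.snoc[OF grown.Nil, of 0 c] by simp
  moreover have "w = [0]" if "length w = 1" "grown c w" for w
    using inversion_sequence_less_length[OF grown_inversion_sequence[OF that(2)]] that(1)
    by (cases w) simp_all
  moreover have "rep_stat [0] = 1" by (simp add: rep_stat_def dist_stat_def)
  ultimately have "{w. length w = 1 \<and> grown c w \<and> rep_stat w = k} = {w. w = [0] \<and> k = 1}"
    by (intro Collect_cong) auto
  then have "card {w. length w = 1 \<and> grown c w \<and> rep_stat w = k} = (if k = 1 then 1 else 0)"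
    by (simp only:) simp
  also have "\<dots> = Stirling 1 k" by (cases k) auto
  finally show ?case .
next
  case (step n)
  show ?case
  proof (cases k)
    case 0
    have "rep_stat w \<noteq> 0" if "length w = Suc n" "grown c w" for w
    proof -
      note inv = grown_inversion_sequence[OF that(2)]
      have "length w \<in> {..length w} - set w"
        using inversion_sequence_less_length[OF inv] by auto
      then have "card ({..length w} - set w) \<noteq> 0" by (auto simp only: card_eq_0_iff)
      moreover have "w \<noteq> []" using that(1) by auto
      ultimately show ?thesis using rep_stat_eq_card_missing[OF inv] by simp
    qed
    then have "{w. length w = Suc n \<and> grown c w \<and> rep_stat w = 0} = {}" by blast
    then show ?thesis unfolding 0 by (simp only:) simp
  next
    case (Suc m)
    show ?thesis
      unfolding Suc Stirling.simps
      using card_grown_rep_Suc[of c n m, OF c step.hyps(1)] unfolding step.IH .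
  qed
qed

section \<open>The two avoidance classes\<close>

lemma subseq_snoc_iff:
  "subseq (u @ [y]) (w @ [x]) \<longleftrightarrow> subseq (u @ [y]) w \<or> (y = x \<and> subseq u w)"
proof (cases "y = x")
  case True
  have "subseq u w" if "subseq (u @ [x]) w"
    using that subseq_order.trans subseq_rev_drop_many by blast
  then show ?thesis using True by auto
next
  case False
  have "subseq (u @ [y]) w" if "subseq (u @ [y]) (w @ [x])"
    using that
  proof (cases rule: subseq_appendE)
    case (append us vs)
    have "y \<notin> set vs" using append(3) False by (auto elim: list_emb_set)
    then have "vs = []" using append(1) by (cases vs rule: rev_cases) auto
    then show ?thesis using append by simp
  qed
  then show ?thesis using False subseq_rev_drop_many by auto
qed

lemma subseq_3_snoc_iff:
  "subseq [a, b, d] (w @ [x]) \<longleftrightarrow> subseq [a, b, d] w \<or> (d = x \<and> subseq [a, b] w)"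
  using subseq_snoc_iff[of "[a, b]"] by simp

lemma subseq_2_snoc_iff:
  "subseq [a, b] (w @ [x]) \<longleftrightarrow> subseq [a, b] w \<or> (b = x \<and> a \<in> set w)"
  using subseq_snoc_iff[of "[a]"] by (simp add: subseq_singleton_left)

lemma subseq_pair_or_swapped:
  assumes "a \<in> set w" "b \<in> set w" "a \<noteq> b"
  shows "subseq [a, b] w \<or> subseq [b, a] w"
  using assms by (induction w rule: rev_induct) (auto simp: subseq_2_snoc_iff)

lemma subseq_pair_in_set: "subseq [a, b] w \<Longrightarrow> a \<in> set w \<and> b \<in> set w"
  by (auto elim: list_emb_set)

lemma order_isomorphic_3_iff:
  "order_isomorphic u [p, q, r] \<longleftrightarrow>
    (\<exists>a b d. u = [a, b, d] \<and> (a < b \<longleftrightarrow> p < q) \<and> (b < a \<longleftrightarrow> q < p) \<and>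
      (a < d \<longleftrightarrow> p < r) \<and> (d < a \<longleftrightarrow> r < p) \<and> (b < d \<longleftrightarrow> q < r) \<and> (d < b \<longleftrightarrow> r < q))"
proof (cases "length u = 3")
  case True
  then obtain a b d where u: "u = [a, b, d]"
    by (auto simp: numeral_3_eq_3 length_Suc_conv)
  have all: "(\<forall>i<length [a, b, d]. P i) \<longleftrightarrow> P 0 \<and> P (Suc 0) \<and> P (Suc (Suc 0))" for P
    by (auto simp: less_Suc_eq)
  have eq: "x = y \<longleftrightarrow> \<not> x < y \<and> \<not> y < x" for x y :: nat by auto
  show ?thesis
    unfolding order_isomorphic_def u all by simp (rule iffI; simp add: eq)
next
  case False
  then show ?thesis by (auto simp: order_isomorphic_def)
qed

lemma avoids_010: "avoids w [0,1,0] \<longleftrightarrow> (\<forall>a b. a < b \<longrightarrow> \<not> subseq [a, b, a] w)"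
  and avoids_101: "avoids w [1,0,1] \<longleftrightarrow> (\<forall>a b. a < b \<longrightarrow> \<not> subseq [b, a, b] w)"
  and avoids_100: "avoids w [1,0,0] \<longleftrightarrow> (\<forall>a b. a < b \<longrightarrow> \<not> subseq [b, a, a] w)"
proof -
  have "order_isomorphic u [0,1,0] \<longleftrightarrow> (\<exists>a b. a < b \<and> u = [a, b, a])" for u
    unfolding order_isomorphic_3_iff by auto
  then show "avoids w [0,1,0] \<longleftrightarrow> (\<forall>a b. a < b \<longrightarrow> \<not> subseq [a, b, a] w)"
    by (auto simp: avoids_def)
  have "order_isomorphic u [1,0,1] \<longleftrightarrow> (\<exists>a b. a < b \<and> u = [b, a, b])" for u
    unfolding order_isomorphic_3_iff by auto
  then show "avoids w [1,0,1] \<longleftrightarrow> (\<forall>a b. a < b \<longrightarrow> \<not> subseq [b, a, b] w)"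
    by (auto simp: avoids_def)
  have "order_isomorphic u [1,0,0] \<longleftrightarrow> (\<exists>a b. a < b \<and> u = [b, a, a])" for u
    unfolding order_isomorphic_3_iff by auto
  then show "avoids w [1,0,0] \<longleftrightarrow> (\<forall>a b. a < b \<longrightarrow> \<not> subseq [b, a, a] w)"
    by (auto simp: avoids_def)
qed

text \<open>
  A new occurrence of a pattern uses the appended entry \<open>x\<close> as its last letter. For \<open>010\<close> and
  \<open>101\<close> together it is an earlier \<open>x\<close> followed by some \<open>b \<noteq> x\<close>. If \<open>x\<close> occurs but is not the last
  entry, the last entry is such a \<open>b\<close>; if \<open>x\<close> is the last entry, then such a \<open>b\<close> lies between two
  entries \<open>x\<close>, so \<open>x b x\<close> has occurred before.
\<close>

lemma avoids_010_101_iff_grown: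
  "inversion_sequence w \<and> avoids w [0,1,0] \<and> avoids w [1,0,1] \<longleftrightarrow> grown last w"
proof -
  have eq: "avoids w [0,1,0] \<and> avoids w [1,0,1] \<longleftrightarrow>
      (\<forall>a b. a \<noteq> b \<longrightarrow> \<not> subseq [a, b, a] w)" for w
    unfolding avoids_010 avoids_101 neq_iff by blast
  show ?thesis
    unfolding eq
  proof (induction w rule: rev_induct)
    case Nil
    show ?case by (simp add: grown.Nil inversion_sequence_def)
  next
    case (snoc x w)
    let ?A = "\<lambda>w. \<forall>a b. a \<noteq> b \<longrightarrow> \<not> subseq [a, b, a] (w :: nat list)"
    have "(\<forall>b. x \<noteq> b \<longrightarrow> \<not> subseq [x, b] w) \<longleftrightarrow> (x \<in> set w \<longrightarrow> x = last w)" if "?A w"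
    proof (cases w rule: rev_cases)
      case Nil
      then show ?thesis by simp
    next
      case (snoc v y)
      have "\<not> subseq [x, b] v" if "x = y" "x \<noteq> b" for b
        using \<open>?A w\<close> that unfolding snoc by (auto simp: subseq_3_snoc_iff)
      then show ?thesis
        unfolding snoc by (auto simp: subseq_2_snoc_iff dest: subseq_pair_in_set)
    qed
    then show ?case
      using snoc.IH by (auto simp: grown_snoc_iff inversion_sequence_snoc_iff subseq_3_snoc_iff)
  qed
qed

text \<open>
  For \<open>010\<close> and \<open>100\<close> together, a new occurrence ending in \<open>x\<close> is an earlier \<open>x\<close> together with
  some \<open>b > x\<close>, in either order. So an old \<open>x\<close> is admissible exactly when nothing exceeds it.
\<close>

lemma avoids_010_100_iff_grown:
  "inversion_sequence w \<and> avoids w [0,1,0] \<and> avoids w [1,0,0] \<longleftrightarrow> grown (\<lambda>w. Max (set w)) w"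
proof (induction w rule: rev_induct)
  case Nil
  show ?case unfolding avoids_010 avoids_100 by (simp add: grown.Nil inversion_sequence_def)
next
  case (snoc x w)
  have "(\<forall>b>x. \<not> subseq [x, b] w \<and> \<not> subseq [b, x] w) \<longleftrightarrow> (x \<in> set w \<longrightarrow> x = Max (set w))"
  proof
    assume *: "\<forall>b>x. \<not> subseq [x, b] w \<and> \<not> subseq [b, x] w"
    show "x \<in> set w \<longrightarrow> x = Max (set w)"
    proof
      assume x: "x \<in> set w"
      then have "b \<le> x" if "b \<in> set w" for b
        using * subseq_pair_or_swapped[OF x that] by (metis less_irrefl not_le)
      then show "x = Max (set w)" using x by (intro Max_eqI[symmetric]) auto
    qed
  next
    assume "x \<in> set w \<longrightarrow> x = Max (set w)"
    then show "\<forall>b>x. \<not> subseq [x, b] w \<and> \<not> subseq [b, x] w"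
      by (metis List.finite_set Max_ge not_le subseq_pair_in_set)
  qed
  then show ?case
    using snoc.IH unfolding avoids_010 avoids_100
    by (auto simp: grown_snoc_iff inversion_sequence_snoc_iff subseq_3_snoc_iff)
qed

text \<open>The word starts with \<open>0\<close>, so any later final \<open>0\<close> is old and the entry before it is \<open>0\<close>.\<close>

lemma grown_last_eq_0:
  assumes "grown last w" "w \<noteq> []" "last w = 0"
  shows "set w \<subseteq> {0}"
  using assms
proof induction
  case (snoc w x)
  show ?case
  proof (cases "w = []")
    case False
    then have "0 \<in> set w"
      using zero_in_inversion_sequence grown_inversion_sequence snoc.hyps(1) by blast
    then show ?thesis using snoc False by auto
  qed (use snoc in auto)
qed simp

theorem theorem5p5:
  fixes n :: nat
  assumes "n \<ge> 1"
  shows "(\<exists>\<phi>. bij_betw \<phi> (inversion_sequences_avoiding n {[0,1,0], [1,0,1]})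
                       (inversion_sequences_avoiding n {[0,1,0], [1,0,0]}) \<and>
           (\<forall>e \<in> inversion_sequences_avoiding n {[0,1,0], [1,0,1]}.
              (dist_stat (\<phi> e), satu_stat (\<phi> e), zero_stat (\<phi> e)) =
              (dist_stat e, satu_stat e, zero_stat e))) \<and>
         (\<forall>k. 1 \<le> k \<and> k \<le> n \<longrightarrow>
           card {e \<in> inversion_sequences_avoiding n {[0,1,0], [1,0,0]}. rep_stat e = k} =
           stirling2 n k)"
proof -
  let ?max = "\<lambda>w :: nat list. Max (set w)"
  have last: "last w \<in> set w" and max: "?max w \<in> set w" if "w \<noteq> []" for w :: "nat list"
    using that by auto
  have max0: "set w \<subseteq> {0}" if "?max w = 0" for w
    using that by (metis List.finite_set Max_ge le_zero_eq singletonI subsetI)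
  have A: "inversion_sequences_avoiding n {[0,1,0], [1,0,1]} = {w. length w = n \<and> grown last w}"
    unfolding inversion_sequences_avoiding_def using avoids_010_101_iff_grown by auto
  have B: "inversion_sequences_avoiding n {[0,1,0], [1,0,0]} = {w. length w = n \<and> grown ?max w}"
    unfolding inversion_sequences_avoiding_def using avoids_010_100_iff_grown by auto
  show ?thesis
    unfolding A B
  proof (intro conjI exI ballI allI impI)
    show "bij_betw (retarget ?max)
        {w. length w = n \<and> grown last w} {w. length w = n \<and> grown ?max w}"
      by (rule bij_betw_retarget[OF max last])
  next
    fix e assume "e \<in> {w. length w = n \<and> grown last w}"
    then have e: "grown last e" by simp
    have "dist_stat (retarget ?max e) = dist_stat e"
      by (rule dist_stat_retarget[OF max])
    moreover have "satu_stat (retarget ?max e) = satu_stat e"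
      by (rule satu_stat_retarget[OF max grown_inversion_sequence[OF e]])
    moreover have "zero_stat (retarget ?max e) = zero_stat e"
      by (rule zero_stat_retarget[OF max last max0 grown_last_eq_0 e])
    ultimately show "(dist_stat (retarget ?max e), satu_stat (retarget ?max e),
        zero_stat (retarget ?max e)) = (dist_stat e, satu_stat e, zero_stat e)"
      by simp
  next
    fix k
    have "card {w. length w = n \<and> grown ?max w \<and> rep_stat w = k} = stirling2 n k"
      unfolding stirling2_eq_Stirling by (rule card_grown_rep[OF max assms])
    then show "card {e \<in> {w. length w = n \<and> grown ?max w}. rep_stat e = k} = stirling2 n k"
      unfolding mem_Collect_eq conj_assoc .
  qed
qed

end
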